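(* If a continuous map $f:[0,1]\to[0,1]$ is mixing then $f$ has the specification property.
   Context: A continuous map $T:X\to X$ of a compact metric space is mixing if for any nonempty open $U,V$ there is $N$ with $T^nU\cap V\ne\emptyset$ for all $n>N$. A continuous map $T:X\to X$ of a compact infinite metric space $(X,d)$ has the specification property if for any $\varepsilon>0$ there exists an integer $M=M(\varepsilon)$ such that for any $k>1$, any $k$ points $x_1,\dots,x_k\in X$, any nonnegative integers $a_1\le b_1<a_2\le b_2<\dots<a_k\le b_k$ with $a_i-b_{i-1}\ge M$ for $2\le i\le k$, and any integer $p\ge M+b_k-a_1$, there exists a point $x\in X$ with $T^px=x$ such that $d(T^nx,T^nx_i)\le\varepsilon$ for $a_i\le n\le b_i$, $1\le i\le k$. *)

theory Defs
  imports "HOL-Analysis.Analysis"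
begin

text \<open>
  A dynamical system \<open>T : X \<rightarrow> X\<close> is a carrier set \<open>X\<close> of a metric space type together with a
  function on the whole type; only the values of \<open>T\<close> on \<open>X\<close> matter, since \<open>X\<close> is invariant.
\<close>

definition continuous_self_map :: "'a::metric_space set \<Rightarrow> ('a \<Rightarrow> 'a) \<Rightarrow> bool" where
  "continuous_self_map X T \<longleftrightarrow> continuous_on X T \<and> T \<in> X \<rightarrow> X"

definition mixing :: "'a::metric_space set \<Rightarrow> ('a \<Rightarrow> 'a) \<Rightarrow> bool" where
  "mixing X T \<longleftrightarrow>
     compact X \<and> continuous_self_map X T \<and>
     (\<forall>U V. openin (top_of_set X) U \<and> U \<noteq> {} \<and> openin (top_of_set X) V \<and> V \<noteq> {} \<longrightarrow>
        (\<exists>N. \<forall>n>N. (T ^^ n) ` U \<inter> V \<noteq> {}))"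

text \<open>
  The gaps and the period bound are compared in \<^typ>\<open>int\<close>, because subtraction on \<^typ>\<open>nat\<close>
  truncates. The period \<open>p\<close> is a natural number, as \<open>T\<close> need not be invertible.
\<close>

definition specification_property :: "'a::metric_space set \<Rightarrow> ('a \<Rightarrow> 'a) \<Rightarrow> bool" where
  "specification_property X T \<longleftrightarrow>
     compact X \<and> infinite X \<and> continuous_self_map X T \<and>
     (\<forall>\<epsilon>::real. \<epsilon> > 0 \<longrightarrow>
        (\<exists>M::int. \<forall>(k::nat) (x :: nat \<Rightarrow> 'a) (a :: nat \<Rightarrow> nat) (b :: nat \<Rightarrow> nat) (p::nat).
           k > 1 \<and>
           (\<forall>i\<in>{1..k}. x i \<in> X) \<and>
           (\<forall>i\<in>{1..k}. a i \<le> b i) \<and>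
           (\<forall>i\<in>{2..k}. b (i - 1) < a i) \<and>
           (\<forall>i\<in>{2..k}. int (a i) - int (b (i - 1)) \<ge> M) \<and>
           int p \<ge> M + int (b k) - int (a 1) \<longrightarrow>
           (\<exists>z\<in>X. (T ^^ p) z = z \<and>
              (\<forall>i\<in>{1..k}. \<forall>n\<in>{a i..b i}. dist ((T ^^ n) z) ((T ^^ n) (x i)) \<le> \<epsilon>))))"

end

theory Submission
  imports Defs
begin

text \<open>
  Around each orbit segment take the interval of points that stay close to it until some iterate of
  the interval has reached a fixed length \<open>r\<close>. By mixing, all intervals of length at least \<open>r\<close> cover
  a fixed core interval after a common number of iterations, so if all the intervals lie in the
  core, each of them covers the next one across a gap; the first one is finally covered again,
  and the intermediate value theorem yields a periodic point with the prescribed itinerary.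

  The core can reach an endpoint \<open>e\<close> only if \<open>e\<close> is the image of an interior point under some
  iterate. Otherwise mixing forces fixed points of \<open>f \<circ> f\<close> arbitrarily close to \<open>e\<close>, and
  orbits that start near \<open>e\<close> are replaced by orbits that wait between two such points.
\<close>

section \<open>Covering relations between intervals\<close>

lemma funpow_add_apply: "(f ^^ (m + n)) x = (f ^^ m) ((f ^^ n) x)"
  by (simp add: funpow_add)

text \<open>Between the last point with value \<open>c\<close> and the first later point with value
  \<open>d\<close>, the intermediate value theorem keeps \<open>h\<close> inside
  \<open>{c..d}\<close>.\<close>

lemma cover_subinterval_aux:
  fixes h :: "real \<Rightarrow> real"
  assumes cont: "continuous_on {p..q} h" and "p \<le> q" and "h p = c" and "h q = d" and "c \<le> d"
  shows "\<exists>\<alpha> \<beta>. p \<le> \<alpha> \<and> \<alpha> \<le> \<beta> \<and> \<beta> \<le> q \<and> h ` {\<alpha>..\<beta>} = {c..d}"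
proof -
  have "closed {x\<in>{p..q}. h x = c}"
    by (intro continuous_closed_preimage_constant cont closed_real_atLeastAtMost)
  then have "compact {x\<in>{p..q}. h x = c}"
    by (auto simp: compact_eq_bounded_closed intro: bounded_subset[OF bounded_closed_interval])
  moreover have "p \<in> {x\<in>{p..q}. h x = c}" using assms by auto
  ultimately obtain \<alpha> where \<alpha>: "\<alpha> \<in> {p..q}" "h \<alpha> = c"
    and \<alpha>_max: "\<And>x. x \<in> {p..q} \<Longrightarrow> h x = c \<Longrightarrow> x \<le> \<alpha>"
    using compact_attains_sup[of "{x\<in>{p..q}. h x = c}"] by blast
  have cont': "continuous_on {\<alpha>..q} h"
    using cont \<alpha> by (auto intro: continuous_on_subset)
  have "closed {x\<in>{\<alpha>..q}. h x = d}"
    by (intro continuous_closed_preimage_constant cont' closed_real_atLeastAtMost)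
  then have "compact {x\<in>{\<alpha>..q}. h x = d}"
    by (auto simp: compact_eq_bounded_closed intro: bounded_subset[OF bounded_closed_interval])
  moreover have "q \<in> {x\<in>{\<alpha>..q}. h x = d}" using assms \<alpha> by auto
  ultimately obtain \<beta> where \<beta>: "\<beta> \<in> {\<alpha>..q}" "h \<beta> = d"
    and \<beta>_min: "\<And>x. x \<in> {\<alpha>..q} \<Longrightarrow> h x = d \<Longrightarrow> \<beta> \<le> x"
    using compact_attains_inf[of "{x\<in>{\<alpha>..q}. h x = d}"] by blast
  have "h t \<in> {c..d}" if t: "t \<in> {\<alpha>..\<beta>}" for t
  proof -
    \<comment> \<open>A value below \<open>c\<close> would have to rise through \<open>c\<close>
      again before \<beta>, after the last point where \<open>c\<close> is taken. The bound by
      \<open>d\<close> is symmetric.\<close>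
    have "\<not> h t < c"
    proof
      assume "h t < c"
      then obtain x where "t \<le> x" "x \<le> \<beta>" "h x = c"
        using IVT'[of h t c \<beta>] t \<beta> \<open>c \<le> d\<close> continuous_on_subset[OF cont', of "{t..\<beta>}"] by auto
      then show False using \<alpha>_max[of x] t \<alpha>(1) \<beta>(1) \<open>h t < c\<close> by (cases "x = t") auto
    qed
    moreover have "\<not> d < h t"
    proof
      assume "d < h t"
      then obtain x where "\<alpha> \<le> x" "x \<le> t" "h x = d"
        using IVT'[of h \<alpha> d t] t \<alpha> \<beta> \<open>c \<le> d\<close> continuous_on_subset[OF cont', of "{\<alpha>..t}"] by auto
      then show False using \<beta>_min[of x] t \<beta>(1) \<open>d < h t\<close> by (cases "x = t") auto
    qed
    ultimately show ?thesis by simp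
  qed
  moreover have "y \<in> h ` {\<alpha>..\<beta>}" if "y \<in> {c..d}" for y
    using IVT'[of h \<alpha> y \<beta>] that \<alpha> \<beta> continuous_on_subset[OF cont', of "{\<alpha>..\<beta>}"] by force
  ultimately have "h ` {\<alpha>..\<beta>} = {c..d}" by blast
  then show ?thesis using \<alpha> \<beta> by auto
qed

text \<open>Preimages of \<open>c\<close> and \<open>d\<close> may lie in either order; the reversed
  order is the ordered case for \<open>- h\<close> with target \<open>{-d..-c}\<close>.\<close>

lemma cover_subinterval:
  fixes h :: "real \<Rightarrow> real"
  assumes cont: "continuous_on {a..b} h" and "c \<le> d" and cover: "{c..d} \<subseteq> h ` {a..b}"
  shows "\<exists>\<alpha> \<beta>. a \<le> \<alpha> \<and> \<alpha> \<le> \<beta> \<and> \<beta> \<le> b \<and> h ` {\<alpha>..\<beta>} = {c..d}"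
proof -
  have "c \<in> h ` {a..b}" "d \<in> h ` {a..b}" using subsetD[OF cover] \<open>c \<le> d\<close> by simp_all
  then obtain p q where pq: "p \<in> {a..b}" "h p = c" "q \<in> {a..b}" "h q = d" by (elim imageE) simp
  show ?thesis
  proof (cases "p \<le> q")
    case True
    then have "continuous_on {p..q} h" using cont pq by (auto intro: continuous_on_subset)
    then obtain \<alpha> \<beta> where "p \<le> \<alpha>" "\<alpha> \<le> \<beta>" "\<beta> \<le> q" "h ` {\<alpha>..\<beta>} = {c..d}"
      using cover_subinterval_aux[OF _ True pq(2,4) \<open>c \<le> d\<close>] by blast
    then show ?thesis using pq(1,3) by (intro exI[of _ \<alpha>] exI[of _ \<beta>]) simp
  next
    case False
    then have le: "q \<le> p" by simp
    have "continuous_on {q..p} (\<lambda>x. - h x)"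
      using cont pq by (intro continuous_intros) (auto intro: continuous_on_subset)
    then obtain \<alpha> \<beta> where ab: "q \<le> \<alpha>" "\<alpha> \<le> \<beta>" "\<beta> \<le> p" "(\<lambda>x. - h x) ` {\<alpha>..\<beta>} = {-d..-c}"
      using cover_subinterval_aux[OF _ le, of "\<lambda>x. - h x" "-d" "-c", simplified pq neg_le_iff_le]
        \<open>c \<le> d\<close> by blast
    have "h ` {\<alpha>..\<beta>} = uminus ` ((\<lambda>x. - h x) ` {\<alpha>..\<beta>})" by (simp add: image_image)
    also have "\<dots> = {c..d}" by (simp add: ab(4))
    finally show ?thesis using ab(1-3) pq(1,3) by (intro exI[of _ \<alpha>] exI[of _ \<beta>]) simp
  qed
qed

text \<open>The function \<open>h x - x\<close> is nonpositive at a preimage of \<open>a\<close> and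
  nonnegative at a preimage of \<open>b\<close>, so it vanishes in between.\<close>

lemma fixed_point_of_cover:
  fixes h :: "real \<Rightarrow> real"
  assumes cont: "continuous_on {a..b} h" and "a \<le> b" and cover: "{a..b} \<subseteq> h ` {a..b}"
  shows "\<exists>x\<in>{a..b}. h x = x"
proof -
  define g where "g x = h x - x" for x
  have conn: "connected (g ` {a..b})"
    unfolding g_def by (intro connected_continuous_image continuous_intros cont) auto
  obtain p where p: "p \<in> {a..b}" "a = h p"
    using subsetD[OF cover, of a] \<open>a \<le> b\<close> unfolding image_iff by fastforce
  obtain q where q: "q \<in> {a..b}" "b = h q"
    using subsetD[OF cover, of b] \<open>a \<le> b\<close> unfolding image_iff by fastforce
  have "g p \<le> 0" "0 \<le> g q" using p q by (simp_all add: g_def)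
  then have "0 \<in> g ` {a..b}"
    using connectedD_interval[OF conn imageI[OF p(1)] imageI[OF q(1)]] by blast
  then obtain x where "x \<in> {a..b}" "g x = 0" by (elim imageE) simp
  then show ?thesis by (intro bexI[of _ x]) (simp add: g_def)
qed

section \<open>Uniform consequences of mixing\<close>

text \<open>Mixing is recorded pointwise, with open intervals as test sets; this form carries over
  directly to the conjugate of \<open>f\<close> by \<open>1 - x\<close>.\<close>

locale interval_mixing =
  fixes f :: "real \<Rightarrow> real"
  assumes cont: "continuous_on {0..1} f"
    and maps: "\<And>x. x \<in> {0..1} \<Longrightarrow> f x \<in> {0..1}"
    and mix: "\<And>a b c d. 0 \<le> a \<Longrightarrow> a < b \<Longrightarrow> b \<le> 1 \<Longrightarrow> 0 \<le> c \<Longrightarrow> c < d \<Longrightarrow> d \<le> 1 \<Longrightarrow>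
      \<exists>N. \<forall>n>N. \<exists>x\<in>{a<..<b}. (f ^^ n) x \<in> {c<..<d}"
begin

lemma iter_maps: "x \<in> {0..1} \<Longrightarrow> (f ^^ n) x \<in> {0..1}"
  by (induction n) (use maps in auto)

lemma iter_cont: "continuous_on {0..1} (f ^^ n)"
proof (induction n)
  case (Suc n)
  have "continuous_on {0..1} (f \<circ> (f ^^ n))"
    using Suc by (rule continuous_on_compose)
      (rule continuous_on_subset[OF cont], use iter_maps in auto)
  then show ?case by simp
qed (simp add: id_def)

lemma iter_cont_sub: "0 \<le> a \<Longrightarrow> b \<le> 1 \<Longrightarrow> continuous_on {a..b} (f ^^ n)"
  by (rule continuous_on_subset[OF iter_cont]) auto

text \<open>If the minimum of \<open>f\<close> were positive, no iterate of positive order could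
  enter the open interval between 0 and the minimum.\<close>

lemma zero_in_range: "\<exists>x\<in>{0..1}. f x = 0"
proof -
  obtain x where x: "x \<in> {0..1}" "\<And>y. y \<in> {0..1} \<Longrightarrow> f x \<le> f y"
    using continuous_attains_inf[OF _ _ cont] by auto
  have "f x = 0"
  proof (rule ccontr)
    assume "f x \<noteq> 0"
    then have "0 < f x" "f x \<le> 1" using maps[OF x(1)] by auto
    then obtain N where N: "\<And>n. n > N \<Longrightarrow> \<exists>y\<in>{0<..<1}. (f ^^ n) y \<in> {0<..<f x}"
      using mix[of 0 1 0 "f x"] by auto
    \<comment> \<open>The order \<open>Suc N\<close> is positive, so this point is a value of
      \<open>f\<close>.\<close>
    obtain y where y: "y \<in> {0<..<1}" "(f ^^ Suc N) y < f x" using N[of "Suc N"] by auto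
    then show False using x(2)[OF iter_maps[of y N]] by auto
  qed
  then show ?thesis using x by auto
qed

text \<open>Cut the unit interval into finitely many cells so short that every interval of length
  \<open>r\<close> contains a whole cell. The mixing times of the cells then have a common
  bound.\<close>

lemma uniform_hit:
  assumes "0 < r" "0 \<le> c" "c < d" "d \<le> 1"
  shows "\<exists>N. \<forall>n\<ge>N. \<forall>s t. 0 \<le> s \<longrightarrow> t \<le> 1 \<longrightarrow> r \<le> t - s \<longrightarrow> (\<exists>x\<in>{s..t}. (f ^^ n) x \<in> {c<..<d})"
proof -
  obtain K where K: "0 < K" "inverse (real K) < r / 2"
    using ex_inverse_of_nat_less[of "r / 2"] \<open>0 < r\<close> by auto
  have "\<forall>i\<in>{..<K}. \<exists>N. \<forall>n>N. \<exists>x\<in>{real i / K<..<(real i + 1) / K}. (f ^^ n) x \<in> {c<..<d}"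
    using assms K by (intro ballI mix) (auto simp: divide_simps)
  from bchoice[OF this] obtain N where N: "\<And>i n. i < K \<Longrightarrow> n > N i \<Longrightarrow>
      \<exists>x\<in>{real i / K<..<(real i + 1) / K}. (f ^^ n) x \<in> {c<..<d}"
    by blast
  \<comment> \<open>The sum serves as an upper bound for all the cell times
    \<open>N i\<close>.\<close>
  show ?thesis
  proof (intro exI[of _ "Suc (\<Sum>i<K. N i)"] allI impI)
    fix n s t
    assume n: "n \<ge> Suc (\<Sum>i<K. N i)" and st: "0 \<le> s" "t \<le> 1" "r \<le> t - s"
    \<comment> \<open>Cell \<open>i\<close> is the first one that starts at or after
      \<open>s\<close>. Rounding up costs less than one cell, and \<open>2 < r * K\<close> leaves a
      complete cell before \<open>t\<close>.\<close>
    define i where "i = nat \<lceil>s * K\<rceil>"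
    have i: "s * K \<le> real i" "real i < s * K + 1"
      unfolding i_def using st(1) K(1) by (simp_all add: of_nat_nat) linarith+
    have "2 < r * K" using K by (simp add: field_simps)
    also have "r * K \<le> (t - s) * K" using st K by (intro mult_right_mono) auto
    finally have t: "real i + 1 < t * K" using i by (simp add: algebra_simps)
    also have "t * K \<le> real K" using st by (simp add: mult_le_cancel_right2)
    finally have "i < K" by simp
    moreover from this have "N i \<le> (\<Sum>i<K. N i)" by (intro member_le_sum) auto
    ultimately obtain x where "x \<in> {real i / K<..<(real i + 1) / K}" "(f ^^ n) x \<in> {c<..<d}"
      using N[of i n] n by auto
    moreover have "s \<le> real i / K" "(real i + 1) / K \<le> t" using i t K by (simp_all add: field_simps)
    ultimately show "\<exists>x\<in>{s..t}. (f ^^ n) x \<in> {c<..<d}" by (intro bexI[of _ x]) auto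
  qed
qed

text \<open>At time \<open>n - k\<close> the image of the interval has points on both sides of the
  interior point \<open>c\<close>, hence contains \<open>c\<close> by connectedness;
  \<open>k\<close> further steps lead to \<open>e\<close>. This reaches an endpoint exactly, where
  mixing alone only gives approach.\<close>

lemma uniform_hit_accessible:
  assumes "0 < r" "0 < c" "c < 1" "(f ^^ k) c = e"
  shows "\<exists>N. \<forall>n\<ge>N. \<forall>s t. 0 \<le> s \<longrightarrow> t \<le> 1 \<longrightarrow> r \<le> t - s \<longrightarrow> (\<exists>x\<in>{s..t}. (f ^^ n) x = e)"
proof -
  obtain N1 where N1: "\<And>n s t. n \<ge> N1 \<Longrightarrow> 0 \<le> s \<Longrightarrow> t \<le> 1 \<Longrightarrow> r \<le> t - s \<Longrightarrow>
      \<exists>x\<in>{s..t}. (f ^^ n) x \<in> {0<..<c}"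
    using uniform_hit[of r 0 c] assms by (meson less_imp_le order_refl)
  obtain N2 where N2: "\<And>n s t. n \<ge> N2 \<Longrightarrow> 0 \<le> s \<Longrightarrow> t \<le> 1 \<Longrightarrow> r \<le> t - s \<Longrightarrow>
      \<exists>x\<in>{s..t}. (f ^^ n) x \<in> {c<..<1}"
    using uniform_hit[of r c 1] assms by (meson less_imp_le order_refl)
  show ?thesis
  proof (intro exI[of _ "N1 + N2 + k"] allI impI)
    fix n s t
    assume n: "n \<ge> N1 + N2 + k" and st: "0 \<le> s" "t \<le> 1" "r \<le> t - s"
    have conn: "connected ((f ^^ (n - k)) ` {s..t})"
      using st by (intro connected_continuous_image iter_cont_sub) auto
    have "N1 \<le> n - k" "N2 \<le> n - k" using n by linarith+
    obtain x where x: "x \<in> {s..t}" "(f ^^ (n - k)) x < c"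
      using N1[OF \<open>N1 \<le> n - k\<close> st] by auto
    obtain y where y: "y \<in> {s..t}" "c < (f ^^ (n - k)) y"
      using N2[OF \<open>N2 \<le> n - k\<close> st] by auto
    have "c \<in> (f ^^ (n - k)) ` {s..t}"
      by (rule connectedD_interval[OF conn imageI[OF x(1)] imageI[OF y(1)]]) (use x y in auto)
    then obtain w where w: "w \<in> {s..t}" "(f ^^ (n - k)) w = c" by (elim imageE) simp
    have "(f ^^ n) w = (f ^^ k) ((f ^^ (n - k)) w)"
      using n by (simp flip: funpow_add_apply)
    then show "\<exists>x\<in>{s..t}. (f ^^ n) x = e" using w assms(4) by (intro bexI[of _ w]) simp_all
  qed
qed

end

section \<open>Exchange of the two endpoints\<close>

text \<open>Conjugation by \<open>1 - x\<close> swaps 0 and 1, so every result about the lower end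
  yields one about the upper end.\<close>

lemma interval_mixing_reflect:
  assumes "interval_mixing f"
  shows "interval_mixing (\<lambda>x. 1 - f (1 - x))"
    and "((\<lambda>x. 1 - f (1 - x)) ^^ n) x = 1 - (f ^^ n) (1 - x)"
proof -
  interpret interval_mixing f by fact
  show it: "((\<lambda>x. 1 - f (1 - x)) ^^ n) x = 1 - (f ^^ n) (1 - x)" for n x
    by (induction n) auto
  show "interval_mixing (\<lambda>x. 1 - f (1 - x))"
  proof
    show "continuous_on {0..1} (\<lambda>x. 1 - f (1 - x))"
      by (intro continuous_intros continuous_on_compose2[OF cont]) auto
    show "1 - f (1 - x) \<in> {0..1}" if "x \<in> {0..1}" for x
      using maps[of "1 - x"] that by auto
    show "\<exists>N. \<forall>n>N. \<exists>x\<in>{a<..<b}. ((\<lambda>x. 1 - f (1 - x)) ^^ n) x \<in> {c<..<d}"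
      if "0 \<le> a" "a < b" "b \<le> 1" "0 \<le> c" "c < d" "d \<le> 1" for a b c d
    proof -
      have "\<exists>N. \<forall>n>N. \<exists>x\<in>{1-b<..<1-a}. (f ^^ n) x \<in> {1-d<..<1-c}"
        using that by (intro mix) auto
      then obtain N where N: "\<forall>n>N. \<exists>x\<in>{1-b<..<1-a}. (f ^^ n) x \<in> {1-d<..<1-c}" ..
      show ?thesis
      proof (intro exI[of _ N] allI impI)
        fix n
        assume "N < n"
        from N[rule_format, OF this]
        obtain x where "x \<in> {1-b<..<1-a}" "(f ^^ n) x \<in> {1-d<..<1-c}" ..
        then show "\<exists>x\<in>{a<..<b}. ((\<lambda>x. 1 - f (1 - x)) ^^ n) x \<in> {c<..<d}"
          by (intro bexI[of _ "1 - x"]) (auto simp: it)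
      qed
    qed
  qed
qed

section \<open>An endpoint that no interior point reaches\<close>

context interval_mixing
begin

lemma one_in_range: "\<exists>x\<in>{0..1}. f x = 1"
proof -
  obtain x where "x \<in> {0..1}" "f (1 - x) = 1"
    using interval_mixing.zero_in_range[OF interval_mixing_reflect(1)[OF interval_mixing_axioms]]
    unfolding right_minus_eq by fastforce
  then show ?thesis by (intro bexI[of _ "1 - x"]) auto
qed

text \<open>
  Passing to the second iterate treats a fixed endpoint and a pair of swapped endpoints alike.
\<close>
lemma inaccessible_zero:
  assumes "\<And>k c. 0 < c \<Longrightarrow> c < 1 \<Longrightarrow> (f ^^ k) c \<noteq> 0"
  shows "f (f 0) = 0" and "\<And>x. x \<in> {0..1} \<Longrightarrow> f (f x) = 0 \<Longrightarrow> x = 0"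
proof -
  have a1: "x = 0 \<or> x = 1" if "x \<in> {0..1}" "f x = 0" for x
    using assms[of x 1] that by fastforce
  have a2: "x = 0 \<or> x = 1" if "x \<in> {0..1}" "f (f x) = 0" for x
    using assms[of x 2] that by (fastforce simp: numeral_2_eq_2)
  obtain x where x: "x \<in> {0..1}" "f x = 0" using zero_in_range by blast
  obtain y where y: "y \<in> {0..1}" "f y = 1" using one_in_range by blast
  \<comment> \<open>If \<open>f 1 = 0\<close>, a point sent to 1 by \<open>f\<close> is sent to 0 by
    \<open>f \<circ> f\<close>, hence is an endpoint, and it must be 0: the endpoints are swapped.
    Otherwise 0 is fixed and is its own only preimage.\<close>
  have ends: "f (f 0) = 0 \<and> f (f 1) \<noteq> 0"
  proof (cases "f 1 = 0")
    case True
    then have "y = 0 \<or> y = 1" using a2[of y] y by simp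
    then have "f 0 = 1" using True y(2) by fastforce
    then show ?thesis using True by simp
  next
    case False
    then have "f 0 = 0" using a1[OF x] x(2) by fastforce
    have "f 1 \<in> {0..1}" by (rule maps) simp
    then have "f (f 1) \<noteq> 0" using a1[of "f 1"] False by fastforce
    then show ?thesis using \<open>f 0 = 0\<close> by simp
  qed
  then show "f (f 0) = 0" by blast
  show "x = 0" if "x \<in> {0..1}" "f (f x) = 0" for x
    using a2[OF that] ends that(2) by blast
qed

text \<open>Mixing holds at all large times, in particular at even ones, and an even iterate cannot
  leave a set invariant under \<open>f \<circ> f\<close>.\<close>

lemma square_not_invariant:
  assumes inv: "\<And>x. x \<in> S \<Longrightarrow> f (f x) \<in> S"
    and "0 \<le> a" "a < b" "b \<le> 1" "{a<..<b} \<subseteq> S"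
    and "0 \<le> c" "c < d" "d \<le> 1" "{c<..<d} \<inter> S = {}"
  shows False
proof -
  obtain N where N: "\<forall>n>N. \<exists>x\<in>{a<..<b}. (f ^^ n) x \<in> {c<..<d}"
    using mix[OF assms(2-4,6-8)] ..
  have it: "(f ^^ (2 * n)) x \<in> S" if "x \<in> S" for n x
    using that by (induction n) (auto intro: inv)
  obtain x where "x \<in> {a<..<b}" "(f ^^ (2 * Suc N)) x \<in> {c<..<d}"
    using N[rule_format, of "2 * Suc N"] by (auto simp del: funpow.simps)
  then show False using it[of x "Suc N"] assms by blast
qed

text \<open>Without such fixed points, \<open>f (f x) - x\<close> has constant sign near 0. A
  negative sign makes a short interval at 0 invariant under \<open>f \<circ> f\<close>, a positive
  one makes the complement of a short interval at 0 invariant; both contradict mixing.\<close>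

lemma square_fixed_points_near_zero:
  assumes inacc: "\<And>k c. 0 < c \<Longrightarrow> c < 1 \<Longrightarrow> (f ^^ k) c \<noteq> 0" and "0 < e"
  shows "\<exists>z. 0 < z \<and> z < e \<and> z < 1 \<and> f (f z) = z"
proof (rule ccontr)
  define e' where "e' = min e 1 / 2"
  have e': "0 < e'" "e' < e" "e' < 1" using \<open>0 < e\<close> by (auto simp: e'_def)
  assume "\<not> ?thesis"
  then have nofix: "f (f z) \<noteq> z" if "0 < z" "z \<le> e'" for z using that e' by force
  have contg: "continuous_on {0..1} (\<lambda>x. f (f x))"
    using iter_cont[of 2] by (simp add: numeral_2_eq_2 o_def)
  have conn: "connected ((\<lambda>x. f (f x) - x) ` {0<..e'})"
    using e' by (intro connected_continuous_image continuous_intros continuous_on_subset[OF contg]) auto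
  have sign: "\<not> (f (f u) < u \<and> f (f v) > v)" if "u \<in> {0<..e'}" "v \<in> {0<..e'}" for u v
  proof
    assume "f (f u) < u \<and> f (f v) > v"
    then have "0 \<in> (\<lambda>x. f (f x) - x) ` {0<..e'}"
      using connectedD_interval[OF conn, of "f (f u) - u" "f (f v) - v" 0] that by auto
    then show False using nofix by force
  qed
  note z = inaccessible_zero[OF inacc]
  show False
  proof (cases "f (f e') < e'")
    case True
    have "f (f x) \<in> {0..e'}" if "x \<in> {0..e'}" for x
    proof (cases "x = 0")
      case False
      then have "f (f x) \<le> x" using sign[of e' x] True that e' by force
      then show ?thesis using that e' maps[OF maps[of x]] by auto
    qed (use z e' in auto)
    then show False
      using e' by (rule_tac square_not_invariant[of "{0..e'}" 0 e' e' 1]) auto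
  next
    case False
    obtain w where w: "w \<in> {e'..1}" "\<And>x. x \<in> {e'..1} \<Longrightarrow> f (f w) \<le> f (f x)"
      using continuous_attains_inf[OF _ _ continuous_on_subset[OF contg], of "{e'..1}"] e' by force
    \<comment> \<open>No value of \<open>f \<circ> f\<close> on \<open>{e'..1}\<close> is below
      \<open>m\<close>, and \<open>m\<close> is positive because \<open>f \<circ> f\<close> sends
      only 0 to 0.\<close>
    define m where "m = min (f (f w)) e'"
    have "f (f w) \<noteq> 0" using z(2)[of w] w e' by auto
    then have m: "0 < m" "m \<le> e'" "m \<le> f (f w)"
      using maps[OF maps[of w]] w e' by (auto simp: m_def)
    have "f (f x) \<in> {m..1}" if x: "x \<in> {m..1}" for x
    proof (cases "x \<le> e'")
      case True
      then have "f (f x) \<ge> x" using sign[of x e'] False nofix[of e'] x e' m by force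
      then show ?thesis using x m maps[OF maps[of x]] by auto
    next
      case False
      then show ?thesis using w(2)[of x] x m maps[OF maps[of x]] by auto
    qed
    then show False
      using e' m by (rule_tac square_not_invariant[of "{m..1}" m 1 0 m]) auto
  qed
qed

text \<open>As \<open>f \<circ> f\<close> fixes both ends, the intermediate value theorem gives each
  point of \<open>{z1..z2}\<close> a preimage in the same interval; repeat this \<open>m\<close>
  times.\<close>

lemma backward_orbit_between_fixed_points:
  assumes "0 \<le> z1" "z1 \<le> z2" "z2 \<le> 1" "f (f z1) = z1" "f (f z2) = z2"
  shows "t \<in> {z1..z2} \<Longrightarrow> \<exists>y\<in>{z1..z2}. (\<forall>i\<le>m. (f ^^ (2 * i)) y \<in> {z1..z2}) \<and> (f ^^ (2 * m)) y = t"
proof (induction m arbitrary: t)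
  case (Suc m)
  obtain t' where t': "t' \<in> {z1..z2}" "f (f t') = t"
    using IVT'[of "f ^^ 2" z1 t z2] iter_cont_sub[of z1 z2 2] assms Suc.prems
    by (auto simp: numeral_2_eq_2)
  from Suc.IH[OF t'(1)] obtain y where y: "y \<in> {z1..z2}"
    "\<forall>i\<le>m. (f ^^ (2 * i)) y \<in> {z1..z2}" "(f ^^ (2 * m)) y = t'" by blast
  then have "(f ^^ (2 * Suc m)) y = t" using t' by simp
  then show ?case using y Suc.prems by (metis le_Suc_eq)
qed auto

text \<open>Take fixed points \<open>z1 < z2\<close> of \<open>f \<circ> f\<close> close to 0 and
  let \<open>l\<close> be \<open>z1\<close>. While the even iterates of \<open>x\<close> stay below
  \<open>z1\<close>, those of \<open>y\<close> wait in \<open>{z1..z2}\<close>; the two orbits merge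
  when that of \<open>x\<close> leaves.\<close>

lemma shadow_from_inside:
  assumes inacc: "\<And>k c. 0 < c \<Longrightarrow> c < 1 \<Longrightarrow> (f ^^ k) c \<noteq> 0" and "0 < \<epsilon>"
  shows "\<exists>l. 0 < l \<and> l \<le> 1/2 \<and>
    (\<forall>x\<in>{0..<l}. \<exists>y\<in>{l..1/2}. \<forall>n. \<bar>(f ^^ n) x - (f ^^ n) y\<bar> \<le> \<epsilon>)"
proof -
  have "uniformly_continuous_on {0..1} f"
    using cont by (simp add: compact_uniformly_continuous)
  \<comment> \<open>The number \<eta> handles odd times, which are one application of
    \<open>f\<close> after an even time.\<close>
  then obtain \<eta> where \<eta>: "\<eta> > 0"
    "\<And>u v. u \<in> {0..1} \<Longrightarrow> v \<in> {0..1} \<Longrightarrow> \<bar>u - v\<bar> < \<eta> \<Longrightarrow> \<bar>f u - f v\<bar> < \<epsilon>"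
    unfolding uniformly_continuous_on_def dist_real_def using \<open>0 < \<epsilon>\<close> by metis
  obtain z2 where z2: "0 < z2" "z2 < \<eta>" "z2 < \<epsilon>" "z2 < 1/2" "f (f z2) = z2"
    using square_fixed_points_near_zero[OF inacc, of "min (min \<eta> \<epsilon>) (1/2)"] \<eta> \<open>0 < \<epsilon>\<close> by auto
  have "uniformly_continuous_on {0..1} (f ^^ 2)"
    using iter_cont by (simp add: compact_uniformly_continuous)
  \<comment> \<open>Since \<open>f (f 0) = 0\<close>, points below \<theta> are sent below
    \<open>z2\<close>. With \<open>z1 < \<theta>\<close>, an orbit passing \<open>z1\<close> cannot
    jump over \<open>z2\<close>.\<close>
  then obtain \<theta> where \<theta>: "\<theta> > 0"
    "\<And>u v. u \<in> {0..1} \<Longrightarrow> v \<in> {0..1} \<Longrightarrow> \<bar>u - v\<bar> < \<theta> \<Longrightarrow> \<bar>(f ^^ 2) u - (f ^^ 2) v\<bar> < z2"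
    unfolding uniformly_continuous_on_def dist_real_def using z2(1) by metis
  obtain z1 where z1: "0 < z1" "z1 < \<theta>" "z1 < z2" "f (f z1) = z1"
    using square_fixed_points_near_zero[OF inacc, of "min \<theta> z2"] \<theta> z2 by auto
  have small: "f (f x) < z2" if "x \<in> {0..<z1}" for x
    using \<theta>(2)[of x 0] inaccessible_zero(1)[OF inacc] that z1 z2 by (auto simp: numeral_2_eq_2)
  have close: "\<bar>(f ^^ n) x - (f ^^ n) y\<bar> \<le> \<epsilon>"
    if xy: "x \<in> {0..1}" "y \<in> {0..1}"
      and "(f ^^ (2 * (n div 2))) x \<in> {0..z2}" "(f ^^ (2 * (n div 2))) y \<in> {0..z2}" for n x y
  proof -
    define m where "m = 2 * (n div 2)"
    define u v where "u = (f ^^ m) x" and "v = (f ^^ m) y"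
    have uv: "u \<in> {0..1}" "v \<in> {0..1}"
      unfolding u_def v_def by (rule iter_maps[OF xy(1)], rule iter_maps[OF xy(2)])
    have "\<bar>u - v\<bar> \<le> z2" using that(3,4) unfolding u_def v_def m_def by auto
    then have "\<bar>u - v\<bar> \<le> \<epsilon>" "\<bar>f u - f v\<bar> \<le> \<epsilon>" using \<eta>(2)[OF uv] z2 by auto
    moreover have "n = m \<or> n = Suc m" unfolding m_def by presburger
    ultimately show ?thesis by (elim disjE) (simp_all add: u_def v_def)
  qed
  have "\<exists>y\<in>{z1..1/2}. \<forall>n. \<bar>(f ^^ n) x - (f ^^ n) y\<bar> \<le> \<epsilon>" if x: "x \<in> {0..<z1}" for x
  proof (cases "\<exists>m. (f ^^ (2 * m)) x \<ge> z1")
    case False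
    \<comment> \<open>An orbit whose even iterates never reach \<open>z1\<close> is shadowed by
      \<open>z1\<close> itself.\<close>
    have "(f ^^ (2 * m)) z1 = z1" for m by (induction m) (auto simp: z1)
    moreover have "(f ^^ (2 * m)) x \<in> {0..z2}" for m
    proof -
      have "(f ^^ (2 * m)) x < z1" using False not_le by blast
      moreover have "(f ^^ (2 * m)) x \<in> {0..1}" using x z1 z2 by (intro iter_maps) simp
      ultimately show ?thesis using z1 by simp
    qed
    ultimately have "\<forall>n. \<bar>(f ^^ n) x - (f ^^ n) z1\<bar> \<le> \<epsilon>"
      using x z1 z2 by (intro allI close) simp_all
    then show ?thesis using z1 z2 by (intro bexI[of _ z1]) simp_all
  next
    case True
    \<comment> \<open>the orbit of \<open>y\<close> stays in \<open>{z1..z2}\<close> up to the exit time \<open>m\<close>, when it merges with that of \<open>x\<close>\<close>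
    define m where "m = (LEAST m. (f ^^ (2 * m)) x \<ge> z1)"
    have m: "(f ^^ (2 * m)) x \<ge> z1" unfolding m_def using True by (rule LeastI_ex)
    have less: "(f ^^ (2 * i)) x < z1" if "i < m" for i
      using not_less_Least[of i] that unfolding m_def by force
    have "m \<noteq> 0" using m x by (intro notI) simp
    then obtain m' where m': "m = Suc m'" using not0_implies_Suc by blast
    have x01: "x \<in> {0..1}" using x z1 z2 by simp
    \<comment> \<open>At the last even time before the exit the point is still below
      \<open>z1\<close>, so the exit point lies in \<open>{z1..z2}\<close> and has a backward orbit
      there.\<close>
    have "(f ^^ (2 * m')) x \<in> {0..<z1}" using less[of m'] iter_maps[OF x01, of "2 * m'"] m' by simp
    from small[OF this] have "(f ^^ (2 * m)) x < z2" using m' by simp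
    then have "\<exists>y\<in>{z1..z2}. (\<forall>i\<le>m. (f ^^ (2 * i)) y \<in> {z1..z2}) \<and> (f ^^ (2 * m)) y = (f ^^ (2 * m)) x"
      using m z1 z2 by (intro backward_orbit_between_fixed_points) simp_all
    then obtain y where y: "y \<in> {z1..z2}" "\<forall>i\<le>m. (f ^^ (2 * i)) y \<in> {z1..z2}"
      "(f ^^ (2 * m)) y = (f ^^ (2 * m)) x" by fast
    have "\<bar>(f ^^ n) x - (f ^^ n) y\<bar> \<le> \<epsilon>" for n
    proof (cases "n < 2 * m")
      case True
      then have i: "n div 2 < m" by auto
      have "y \<in> {0..1}" using y(1) z1 z2 by simp
      moreover have "(f ^^ (2 * (n div 2))) x \<in> {0..z2}"
        using less[OF i] iter_maps[OF x01, of "2 * (n div 2)"] z1(3) by simp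
      moreover have "(f ^^ (2 * (n div 2))) y \<in> {0..z2}"
        using y(2)[rule_format, of "n div 2"] i z1(1) by simp
      ultimately show ?thesis by (intro close x01)
    next
      case False
      then have "(f ^^ n) w = (f ^^ (n - 2 * m)) ((f ^^ (2 * m)) w)" for w
        by (simp flip: funpow_add_apply)
      then show ?thesis using y(3) \<open>0 < \<epsilon>\<close> by simp
    qed
    then show ?thesis using y(1) z2 by (intro bexI[of _ y]) simp_all
  qed
  then show ?thesis using z1 z2 by (intro exI[of _ z1]) simp
qed

section \<open>The ends of the core interval\<close>

text \<open>If an interior point reaches 0, then \<open>l = 0\<close> works and nothing has to be
  replaced. Otherwise \<open>l > 0\<close>, and mixing into the open interval from 0 to
  \<open>l / 2\<close> suffices. The core will start at \<open>l / 2\<close>, leaving room around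
  replacement points, which are at least \<open>l\<close>.\<close>

lemma lower_core:
  assumes "0 < \<epsilon>"
  shows "\<exists>l\<in>{0..1/2}.
    (\<forall>r>0. \<exists>N. \<forall>n\<ge>N. \<forall>s t. 0 \<le> s \<longrightarrow> t \<le> 1 \<longrightarrow> r \<le> t - s \<longrightarrow> (\<exists>x\<in>{s..t}. (f ^^ n) x \<le> l / 2)) \<and>
    (\<forall>x\<in>{0..<l}. \<exists>y\<in>{l..1/2}. \<forall>n. \<bar>(f ^^ n) x - (f ^^ n) y\<bar> \<le> \<epsilon>)"
proof (cases "\<exists>k c. 0 < c \<and> c < 1 \<and> (f ^^ k) c = 0")
  case True
  then obtain k c where "0 < c" "c < 1" "(f ^^ k) c = 0" by auto
  from uniform_hit_accessible[OF _ this] show ?thesis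
    by (intro bexI[of _ 0]) (simp_all, metis order_refl)
next
  case False
  then obtain l where l: "0 < l" "l \<le> 1/2"
    "\<forall>x\<in>{0..<l}. \<exists>y\<in>{l..1/2}. \<forall>n. \<bar>(f ^^ n) x - (f ^^ n) y\<bar> \<le> \<epsilon>"
    using shadow_from_inside assms by metis
  have "\<exists>N. \<forall>n\<ge>N. \<forall>s t. 0 \<le> s \<longrightarrow> t \<le> 1 \<longrightarrow> r \<le> t - s \<longrightarrow> (\<exists>x\<in>{s..t}. (f ^^ n) x \<le> l / 2)"
    if "r > 0" for r
    using uniform_hit[OF that, of 0 "l / 2"] l(1,2)
    by simp (metis less_imp_le)
  then show ?thesis using l by (intro bexI[of _ l] conjI allI impI) simp_all
qed

text \<open>This is the lower case for the reflected map, with \<open>u = 1 - l\<close>, so that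
  \<open>(1 + u) / 2\<close> is \<open>1 - l / 2\<close>.\<close>

lemma upper_core:
  assumes "0 < \<epsilon>"
  shows "\<exists>u\<in>{1/2..1}.
    (\<forall>r>0. \<exists>N. \<forall>n\<ge>N. \<forall>s t. 0 \<le> s \<longrightarrow> t \<le> 1 \<longrightarrow> r \<le> t - s \<longrightarrow>
      (\<exists>x\<in>{s..t}. (f ^^ n) x \<ge> (1 + u) / 2)) \<and>
    (\<forall>x\<in>{u<..1}. \<exists>y\<in>{1/2..u}. \<forall>n. \<bar>(f ^^ n) x - (f ^^ n) y\<bar> \<le> \<epsilon>)"
proof -
  note reflect = interval_mixing_reflect[OF interval_mixing_axioms]
  obtain l where l: "l \<in> {0..1/2}"
    and hit: "\<forall>r>0. \<exists>N. \<forall>n\<ge>N. \<forall>s t. 0 \<le> s \<longrightarrow> t \<le> 1 \<longrightarrow> r \<le> t - s \<longrightarrow>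
      (\<exists>x\<in>{s..t}. 1 - (f ^^ n) (1 - x) \<le> l / 2)"
    and shadow: "\<forall>x\<in>{0..<l}. \<exists>y\<in>{l..1/2}.
      \<forall>n. \<bar>(1 - (f ^^ n) (1 - x)) - (1 - (f ^^ n) (1 - y))\<bar> \<le> \<epsilon>"
    using interval_mixing.lower_core[OF reflect(1) assms, unfolded reflect(2)]
    by (elim bexE conjE) (rule that)
  have hit': "\<exists>N. \<forall>n\<ge>N. \<forall>s t. 0 \<le> s \<longrightarrow> t \<le> 1 \<longrightarrow> r \<le> t - s \<longrightarrow>
      (\<exists>x\<in>{s..t}. (f ^^ n) x \<ge> (1 + (1 - l)) / 2)" if r: "r > 0" for r
  proof -
    obtain N where N: "\<forall>n\<ge>N. \<forall>s t. 0 \<le> s \<longrightarrow> t \<le> 1 \<longrightarrow> r \<le> t - s \<longrightarrow>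
        (\<exists>x\<in>{s..t}. 1 - (f ^^ n) (1 - x) \<le> l / 2)"
      using hit[rule_format, OF r] ..
    show ?thesis
    proof (intro exI[of _ N] allI impI)
      fix n s t
      assume "n \<ge> N" "0 \<le> s" "t \<le> 1" "r \<le> t - s"
      then have "\<exists>x\<in>{1-t..1-s}. 1 - (f ^^ n) (1 - x) \<le> l / 2"
        by (intro N[rule_format]) simp_all
      then obtain x where "x \<in> {1-t..1-s}" "1 - (f ^^ n) (1 - x) \<le> l / 2" ..
      then show "\<exists>x\<in>{s..t}. (f ^^ n) x \<ge> (1 + (1 - l)) / 2"
        by (intro bexI[of _ "1 - x"]) (auto simp: field_simps)
    qed
  qed
  have shadow': "\<exists>y\<in>{1/2..1-l}. \<forall>n. \<bar>(f ^^ n) x - (f ^^ n) y\<bar> \<le> \<epsilon>" if x: "x \<in> {1-l<..1}" for x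
  proof -
    have "1 - x \<in> {0..<l}" using x by auto
    from shadow[rule_format, OF this] obtain y where y: "y \<in> {l..1/2}"
      "\<forall>n. \<bar>(1 - (f ^^ n) (1 - (1 - x))) - (1 - (f ^^ n) (1 - y))\<bar> \<le> \<epsilon>" ..
    have "\<bar>(f ^^ n) x - (f ^^ n) (1 - y)\<bar> \<le> \<epsilon>" for n
      using y(2)[rule_format, of n] by (simp add: abs_minus_commute)
    then show ?thesis using y(1) by (intro bexI[of _ "1 - y"]) auto
  qed
  show ?thesis
  proof (rule bexI[of _ "1 - l"], intro conjI allI impI ballI)
    show "1 - l \<in> {1/2..1}" using l by simp
  qed (fact hit', fact shadow')
qed

section \<open>Intervals that shadow one orbit segment\<close>

text \<open>Move away from \<open>y\<close> until, for the first time, some iterate up to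
  \<open>n\<close> is at distance \<open>r\<close> from the orbit of \<open>y\<close>. The interval
  swept out stays close up to time \<open>n\<close>, and that iterate stretches it to length at
  least \<open>r\<close>.\<close>

lemma bowen_interval:
  assumes y: "y \<in> {0..1}" and r: "0 < r" "r \<le> 1/2"
  shows "\<exists>c d. 0 \<le> c \<and> c \<le> d \<and> d \<le> 1 \<and> (\<forall>t\<in>{c..d}. \<forall>k\<le>n. \<bar>(f ^^ k) t - (f ^^ k) y\<bar> \<le> r) \<and>
    (\<exists>k\<le>n. \<exists>s\<in>{c..d}. \<exists>t\<in>{c..d}. r \<le> \<bar>(f ^^ k) s - (f ^^ k) t\<bar>)"
proof -
  \<comment> \<open>\<open>e\<close> is the endpoint far from \<open>y\<close>, so that the constraint \<open>k = 0\<close> is violated on the way\<close>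
  define e :: real where "e = (if y \<le> 1/2 then 1 else 0)"
  define w where "w s = y + s * (e - y)" for s
  define \<phi> where "\<phi> k s = \<bar>(f ^^ k) (w s) - (f ^^ k) y\<bar>" for k s
  have seg: "w ` {0..s} = closed_segment y (w s)" if "0 \<le> s" for s
  proof -
    have "closed_segment y (w s) = (\<lambda>u. y + u * (s * (e - y))) ` {0..1}"
      unfolding closed_segment_image_interval by (intro image_cong) (auto simp: w_def algebra_simps)
    also have "\<dots> = w ` ((\<lambda>u. u * s) ` {0..1})" by (simp add: image_image w_def mult.assoc)
    also have "(\<lambda>u. u * s) ` {0..1} = {0..s}" using image_mult_atLeastAtMost_if'[of s 0 1] that by auto
    finally show ?thesis ..
  qed
  have w01: "w s \<in> {0..1}" if "s \<in> {0..1}" for s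
  proof -
    have "w s \<in> w ` {0..1}" using that by (rule imageI)
    then have "w s \<in> closed_segment y e" using seg[of 1] by (simp add: w_def[of 1])
    moreover have "closed_segment y e \<subseteq> {0..1}" using y
      by (auto simp: closed_segment_eq_real_ivl e_def)
    ultimately show ?thesis by blast
  qed
  have \<phi>_cont: "continuous_on {0..1} (\<phi> k)" for k
  proof -
    have "continuous_on {0..1} w" unfolding w_def by (intro continuous_intros)
    then have "continuous_on {0..1} (\<lambda>s. (f ^^ k) (w s))"
      by (rule continuous_on_compose2[OF iter_cont]) (rule image_subsetI, rule w01)
    then show ?thesis unfolding \<phi>_def by (intro continuous_intros)
  qed
  \<comment> \<open>These are the parameters at which some constraint is attained or violated; the
    least one is the stopping parameter.\<close>
  define S where "S = (\<Union>k\<le>n. {0..1} \<inter> \<phi> k -` {r..})"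
  have "closed ({0..1} \<inter> \<phi> k -` {r..})" for k
    by (rule continuous_closed_preimage[OF \<phi>_cont]) auto
  then have "closed S" unfolding S_def by (intro closed_UN) auto
  moreover have "bounded S" by (rule bounded_subset[of "{0..1}"]) (auto simp: S_def)
  ultimately have "compact S" by (simp add: compact_eq_bounded_closed)
  moreover have "1 \<in> S" using y r by (auto simp: S_def \<phi>_def w_def e_def intro!: bexI[of _ 0])
  ultimately obtain s0 where s0: "s0 \<in> S" "\<And>s. s \<in> S \<Longrightarrow> s0 \<le> s"
    using compact_attains_inf[of S] by auto
  then have s01: "s0 \<in> {0..1}" by (auto simp: S_def)
  \<comment> \<open>A distance above \<open>r\<close> would, by the intermediate value theorem, have
    been preceded by a parameter with distance exactly \<open>r\<close>.\<close>
  have le: "\<phi> k s \<le> r" if k: "k \<le> n" and s: "s \<in> {0..s0}" for k s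
  proof (rule ccontr)
    assume gt: "\<not> \<phi> k s \<le> r"
    have "\<phi> k 0 = 0" by (simp add: \<phi>_def w_def)
    moreover have "continuous_on {0..s} (\<phi> k)"
      using that s01 by (auto intro: continuous_on_subset[OF \<phi>_cont])
    ultimately obtain x where x: "0 \<le> x" "x \<le> s" "\<phi> k x = r"
      using IVT'[of "\<phi> k" 0 r s] gt r(1) s by auto
    then have "x \<in> S" using that s01 by (auto simp: S_def)
    then show False using s0(2)[of x] x s gt by (cases "x = s") auto
  qed
  \<comment> \<open>The motion may run to the left or to the right, so the ends are put in
    order.\<close>
  obtain c d where cd: "c \<le> d" "closed_segment y (w s0) = {c..d}"
    by (auto simp: closed_segment_eq_real_ivl split: if_splits) (metis nle_le)
  have "{c..d} = w ` {0..s0}" using seg s01 cd by auto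
  then have 1: "\<forall>t\<in>{c..d}. \<forall>k\<le>n. \<bar>(f ^^ k) t - (f ^^ k) y\<bar> \<le> r"
    using le by (auto simp: \<phi>_def)
  have "{c..d} \<subseteq> {0..1}" using \<open>{c..d} = w ` {0..s0}\<close> w01 s01 by force
  then have 2: "0 \<le> c" "d \<le> 1" using cd(1) by auto
  obtain k where "k \<le> n" "r \<le> \<phi> k s0" using s0(1) by (auto simp: S_def)
  moreover have "w s0 \<in> {c..d}" "y \<in> {c..d}" using cd(2) by auto
  ultimately have "\<exists>k\<le>n. \<exists>s\<in>{c..d}. \<exists>t\<in>{c..d}. r \<le> \<bar>(f ^^ k) s - (f ^^ k) t\<bar>"
    unfolding \<phi>_def by (intro exI[of _ k] conjI bexI[of _ "w s0"] bexI[of _ y])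
  with 1 2 cd(1) show ?thesis by (rule_tac exI[of _ c], rule_tac exI[of _ d], intro conjI)
qed

text \<open>The bound \<open>M\<close> depends on \<epsilon> alone: the interval reaches length
  \<open>r\<close> at some time up to \<open>n\<close>, and all intervals of that length cover the
  core after a common time. Half of \<epsilon> pays for replacing \<open>x\<close> by a point of
  \<open>{l..u}\<close>, half for the radius.\<close>

lemma shadowing_interval:
  assumes "0 < \<epsilon>"
  shows "\<exists>A B M. 0 \<le> A \<and> B \<le> 1 \<and> (\<forall>x\<in>{0..1}. \<forall>n. \<exists>c d. A \<le> c \<and> c \<le> d \<and> d \<le> B \<and>
    (\<forall>t\<in>{c..d}. \<forall>k\<le>n. \<bar>(f ^^ k) t - (f ^^ k) x\<bar> \<le> \<epsilon>) \<and>
    (\<forall>m\<ge>n + M. {A..B} \<subseteq> (f ^^ m) ` {c..d}))"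
proof -
  have e2: "0 < \<epsilon> / 2" using assms by simp
  obtain l where l: "l \<in> {0..1/2}"
    and lhit: "\<forall>r>0. \<exists>N. \<forall>n\<ge>N. \<forall>s t. 0 \<le> s \<longrightarrow> t \<le> 1 \<longrightarrow> r \<le> t - s \<longrightarrow>
      (\<exists>x\<in>{s..t}. (f ^^ n) x \<le> l / 2)"
    and lshadow: "\<forall>x\<in>{0..<l}. \<exists>y\<in>{l..1/2}. \<forall>n. \<bar>(f ^^ n) x - (f ^^ n) y\<bar> \<le> \<epsilon> / 2"
    using lower_core[OF e2] by (elim bexE conjE) (rule that)
  obtain u where u: "u \<in> {1/2..1}"
    and uhit: "\<forall>r>0. \<exists>N. \<forall>n\<ge>N. \<forall>s t. 0 \<le> s \<longrightarrow> t \<le> 1 \<longrightarrow> r \<le> t - s \<longrightarrow>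
      (\<exists>x\<in>{s..t}. (f ^^ n) x \<ge> (1 + u) / 2)"
    and ushadow: "\<forall>x\<in>{u<..1}. \<exists>y\<in>{1/2..u}. \<forall>n. \<bar>(f ^^ n) x - (f ^^ n) y\<bar> \<le> \<epsilon> / 2"
    using upper_core[OF e2] by (elim bexE conjE) (rule that)
  define A B where "A = l / 2" and "B = (1 + u) / 2"
  \<comment> \<open>radius small enough that intervals around points of \<open>{l..u}\<close> stay inside \<open>{A..B}\<close>\<close>
  define r where "r = Min {\<epsilon> / 2, 1/2, if l = 0 then 1 else l / 2, if u = 1 then 1 else (1 - u) / 2}"
  \<comment> \<open>The entries 1 in the minimum are neutral: at an end where the core touches 0 or
    1, no margin is required.\<close>
  have r: "0 < r" "r \<le> \<epsilon> / 2" "r \<le> 1/2" "l \<noteq> 0 \<Longrightarrow> r \<le> l / 2" "u \<noteq> 1 \<Longrightarrow> r \<le> (1 - u) / 2"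
    using e2 l u unfolding r_def by (auto simp: min_def)
  obtain N1 where N1: "\<forall>n\<ge>N1. \<forall>s t. 0 \<le> s \<longrightarrow> t \<le> 1 \<longrightarrow> r \<le> t - s \<longrightarrow>
      (\<exists>x\<in>{s..t}. (f ^^ n) x \<le> A)"
    using lhit[rule_format, OF r(1)] unfolding A_def ..
  obtain N2 where N2: "\<forall>n\<ge>N2. \<forall>s t. 0 \<le> s \<longrightarrow> t \<le> 1 \<longrightarrow> r \<le> t - s \<longrightarrow>
      (\<exists>x\<in>{s..t}. (f ^^ n) x \<ge> B)"
    using uhit[rule_format, OF r(1)] unfolding B_def ..
  have cover: "{A..B} \<subseteq> (f ^^ n) ` {s..t}" if n: "n \<ge> N1 + N2" and st: "0 \<le> s" "t \<le> 1" "r \<le> t - s"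
    for n s t
  proof -
    have n': "N1 \<le> n" "N2 \<le> n" using n by linarith+
    have conn: "connected ((f ^^ n) ` {s..t})"
      using st by (intro connected_continuous_image iter_cont_sub) auto
    obtain x where x: "x \<in> {s..t}" "(f ^^ n) x \<le> A" using N1[rule_format, OF n'(1) st] ..
    obtain y where y: "y \<in> {s..t}" "B \<le> (f ^^ n) y" using N2[rule_format, OF n'(2) st] ..
    have "{(f ^^ n) x..(f ^^ n) y} \<subseteq> (f ^^ n) ` {s..t}"
      by (rule connected_contains_Icc[OF conn imageI[OF x(1)] imageI[OF y(1)]])
    moreover have "{A..B} \<subseteq> {(f ^^ n) x..(f ^^ n) y}" using x y by simp
    ultimately show ?thesis by (rule order_trans[rotated])
  qed
  have "\<exists>c d. A \<le> c \<and> c \<le> d \<and> d \<le> B \<and>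
      (\<forall>t\<in>{c..d}. \<forall>k\<le>n. \<bar>(f ^^ k) t - (f ^^ k) x\<bar> \<le> \<epsilon>) \<and>
      (\<forall>m\<ge>n + (N1 + N2). {A..B} \<subseteq> (f ^^ m) ` {c..d})" if x: "x \<in> {0..1}" for x n
  proof -
    have "\<exists>y\<in>{l..u}. \<forall>n. \<bar>(f ^^ n) x - (f ^^ n) y\<bar> \<le> \<epsilon> / 2"
    proof -
      consider "x \<in> {0..<l}" | "x \<in> {u<..1}" | "x \<in> {l..u}" using x by fastforce
      then show ?thesis
      proof cases
        case 1
        from lshadow[rule_format, OF this] show ?thesis
          by (rule bexE) (rule bexI, assumption, use u in simp)
      next
        case 2
        from ushadow[rule_format, OF this] show ?thesis
          by (rule bexE) (rule bexI, assumption, use l in simp)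
      next
        case 3
        then show ?thesis using e2 by (intro bexI[of _ x]) simp_all
      qed
    qed
    then obtain y where y: "y \<in> {l..u}" "\<forall>n. \<bar>(f ^^ n) x - (f ^^ n) y\<bar> \<le> \<epsilon> / 2" ..
    have y01: "y \<in> {0..1}" using y(1) l u by auto
    obtain c d k s t where cd: "0 \<le> c" "c \<le> d" "d \<le> 1"
      and near0: "\<forall>t\<in>{c..d}. \<forall>k\<le>n. \<bar>(f ^^ k) t - (f ^^ k) y\<bar> \<le> r"
      and k: "k \<le> n" "s \<in> {c..d}" "t \<in> {c..d}" "r \<le> \<bar>(f ^^ k) s - (f ^^ k) t\<bar>"
      using bowen_interval[OF y01 r(1,3), of n] by (elim exE conjE bexE) (rule that)
    note near = near0[rule_format]
    \<comment> \<open>Closeness at time 0 bounds the distance from \<open>c\<close> to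
      \<open>y\<close> by \<open>r\<close>, which is at most the margin
      \<open>l / 2\<close>.\<close>
    have "A \<le> c" using near[of c 0] cd y(1) r(4) by (cases "l = 0") (auto simp: A_def)
    moreover have "d \<le> B" using near[of d 0] cd y(1) r(5) by (cases "u = 1") (auto simp: B_def)
    moreover have "\<bar>(f ^^ k) t - (f ^^ k) x\<bar> \<le> \<epsilon>" if "t \<in> {c..d}" "k \<le> n" for t k
      using near[OF that] y(2)[rule_format, of k] r(2) by linarith
    moreover have "{A..B} \<subseteq> (f ^^ m) ` {c..d}" if m: "m \<ge> n + (N1 + N2)" for m
    proof -
      define p q where "p = min ((f ^^ k) s) ((f ^^ k) t)" and "q = max ((f ^^ k) s) ((f ^^ k) t)"
      have st01: "s \<in> {0..1}" "t \<in> {0..1}" using k cd by auto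
      have pq: "0 \<le> p" "q \<le> 1" "r \<le> q - p"
        using iter_maps[OF st01(1), of k] iter_maps[OF st01(2), of k] k(4)
        by (auto simp: p_def q_def min_def max_def)
      have "connected ((f ^^ k) ` {c..d})"
        using cd by (intro connected_continuous_image iter_cont_sub) auto
      moreover have "p \<in> (f ^^ k) ` {c..d}" "q \<in> (f ^^ k) ` {c..d}"
        using k(2,3) by (auto simp: p_def q_def min_def max_def)
      ultimately have sub: "{p..q} \<subseteq> (f ^^ k) ` {c..d}"
        by (intro connected_contains_Icc)
      \<comment> \<open>As \<open>k \<le> n\<close>, at least \<open>N1 + N2\<close> steps remain
        after time \<open>k\<close>.\<close>
      have "{A..B} \<subseteq> (f ^^ (m - k)) ` {p..q}" using m k(1) by (intro cover pq) auto
      also have "\<dots> \<subseteq> (f ^^ (m - k)) ` (f ^^ k) ` {c..d}" using sub by (rule image_mono)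
      also have "\<dots> = (f ^^ m) ` {c..d}"
        using m k(1) by (simp add: image_comp flip: funpow_add)
      finally show ?thesis .
    qed
    ultimately show ?thesis using cd(2) by (rule_tac exI[of _ c], rule_tac exI[of _ d], intro conjI ballI allI impI)
  qed
  moreover have "0 \<le> A" "B \<le> 1" using l u by (auto simp: A_def B_def)
  ultimately show ?thesis
    by (rule_tac exI[of _ A], rule_tac exI[of _ B], rule_tac exI[of _ "N1 + N2"], intro conjI ballI allI)
qed

section \<open>Chaining the segments and closing the orbit\<close>

text \<open>Induction on \<open>k\<close>: shrink the current interval so that its image is exactly
  the next target. Exactness lets the next covering be applied, and shrinking preserves the earlier
  inclusions. The clause \<open>a 1 \<le> a k\<close> makes the natural-number exponents add
  up.\<close>

lemma chain_interval:
  fixes c d :: "nat \<Rightarrow> real" and a :: "nat \<Rightarrow> nat"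
  assumes J: "\<And>i. i \<in> {1..k} \<Longrightarrow> 0 \<le> c i \<and> c i \<le> d i \<and> d i \<le> 1"
    and a: "\<And>i. i \<in> {1..<k} \<Longrightarrow> a i \<le> a (Suc i)"
    and cover: "\<And>i. i \<in> {1..<k} \<Longrightarrow> {c (Suc i)..d (Suc i)} \<subseteq> (f ^^ (a (Suc i) - a i)) ` {c i..d i}"
    and "1 \<le> k"
  shows "\<exists>\<alpha> \<beta>. c 1 \<le> \<alpha> \<and> \<alpha> \<le> \<beta> \<and> \<beta> \<le> d 1 \<and> a 1 \<le> a k \<and>
    (\<forall>i\<in>{1..k}. (f ^^ (a i - a 1)) ` {\<alpha>..\<beta>} \<subseteq> {c i..d i}) \<and>
    (f ^^ (a k - a 1)) ` {\<alpha>..\<beta>} = {c k..d k}"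
  using \<open>1 \<le> k\<close> J a cover
proof (induction k rule: nat_induct_at_least)
  case base
  then show ?case by (rule_tac exI[of _ "c 1"], rule_tac exI[of _ "d 1"]) auto
next
  case (Suc k)
  have "\<exists>\<alpha> \<beta>. c 1 \<le> \<alpha> \<and> \<alpha> \<le> \<beta> \<and> \<beta> \<le> d 1 \<and> a 1 \<le> a k \<and>
    (\<forall>i\<in>{1..k}. (f ^^ (a i - a 1)) ` {\<alpha>..\<beta>} \<subseteq> {c i..d i}) \<and>
    (f ^^ (a k - a 1)) ` {\<alpha>..\<beta>} = {c k..d k}"
    by (rule Suc.IH) (use Suc.prems in auto)
  then obtain \<alpha> \<beta> where ab: "c 1 \<le> \<alpha>" "\<alpha> \<le> \<beta>" "\<beta> \<le> d 1" "a 1 \<le> a k"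
    and sub: "\<forall>i\<in>{1..k}. (f ^^ (a i - a 1)) ` {\<alpha>..\<beta>} \<subseteq> {c i..d i}"
    and im: "(f ^^ (a k - a 1)) ` {\<alpha>..\<beta>} = {c k..d k}" by (elim exE conjE) (rule that)
  have ak: "a k \<le> a (Suc k)" using Suc.prems(2)[of k] Suc.hyps by auto
  have "{c (Suc k)..d (Suc k)} \<subseteq> (f ^^ (a (Suc k) - a k)) ` (f ^^ (a k - a 1)) ` {\<alpha>..\<beta>}"
    unfolding im using Suc.prems(3)[of k] Suc.hyps by auto
  also have "\<dots> = (f ^^ (a (Suc k) - a 1)) ` {\<alpha>..\<beta>}"
    using ab(4) ak by (simp add: image_comp flip: funpow_add)
  finally have cov: "{c (Suc k)..d (Suc k)} \<subseteq> (f ^^ (a (Suc k) - a 1)) ` {\<alpha>..\<beta>}" .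
  have "0 \<le> c 1" "d 1 \<le> 1" "c (Suc k) \<le> d (Suc k)" using Suc.prems(1) Suc.hyps by auto
  then have "0 \<le> \<alpha>" "\<beta> \<le> 1" using ab by linarith+
  from cover_subinterval[OF iter_cont_sub[OF this] \<open>c (Suc k) \<le> d (Suc k)\<close> cov]
  obtain \<alpha>' \<beta>' where ab': "\<alpha> \<le> \<alpha>'" "\<alpha>' \<le> \<beta>'" "\<beta>' \<le> \<beta>"
    and im': "(f ^^ (a (Suc k) - a 1)) ` {\<alpha>'..\<beta>'} = {c (Suc k)..d (Suc k)}"
    by (elim exE conjE) (rule that)
  have sub': "(f ^^ (a i - a 1)) ` {\<alpha>'..\<beta>'} \<subseteq> {c i..d i}" if "i \<in> {1..Suc k}" for i
  proof (cases "i = Suc k")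
    case False
    then have "i \<in> {1..k}" using that by auto
    have "{\<alpha>'..\<beta>'} \<subseteq> {\<alpha>..\<beta>}" using ab' by auto
    from image_mono[OF this] sub[rule_format, OF \<open>i \<in> {1..k}\<close>] show ?thesis by (rule order_trans)
  next
    case True
    show ?thesis unfolding True im' by simp
  qed
  show ?case
  proof (rule exI[of _ \<alpha>'], rule exI[of _ \<beta>'], intro conjI ballI)
    show "c 1 \<le> \<alpha>'" "\<alpha>' \<le> \<beta>'" "\<beta>' \<le> d 1" "a 1 \<le> a (Suc k)" using ab ab' ak by linarith+
  qed (fact sub', fact im')
qed

text \<open>Each shadowing interval is built for the point reached at time \<open>a i\<close> and
  the duration \<open>b i - a i\<close>. The gaps give the coverings of the chain, and the bound on
  \<open>p\<close> lets the last interval cover the first, which produces a point of period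
  \<open>p\<close>.\<close>

lemma has_specification_property: "specification_property {0..1} f"
proof -
  have "\<exists>M::int. \<forall>k (x :: nat \<Rightarrow> real) a b p.
           k > 1 \<and>
           (\<forall>i\<in>{1..k}. x i \<in> {0..1}) \<and>
           (\<forall>i\<in>{1..k}. a i \<le> b i) \<and>
           (\<forall>i\<in>{2..k}. b (i - 1) < a i) \<and>
           (\<forall>i\<in>{2..k}. int (a i) - int (b (i - 1)) \<ge> M) \<and>
           int p \<ge> M + int (b k) - int (a 1) \<longrightarrow>
           (\<exists>z\<in>{0..1}. (f ^^ p) z = z \<and>
              (\<forall>i\<in>{1..k}. \<forall>n\<in>{a i..b i}. dist ((f ^^ n) z) ((f ^^ n) (x i)) \<le> \<epsilon>))"
    if eps: "0 < \<epsilon>" for \<epsilon>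
  proof -
    obtain A B M where AB: "0 \<le> A" "B \<le> 1"
      and piece: "\<forall>x\<in>{0..1}. \<forall>n. \<exists>c d. A \<le> c \<and> c \<le> d \<and> d \<le> B \<and>
        (\<forall>t\<in>{c..d}. \<forall>k\<le>n. \<bar>(f ^^ k) t - (f ^^ k) x\<bar> \<le> \<epsilon>) \<and>
        (\<forall>m\<ge>n + M. {A..B} \<subseteq> (f ^^ m) ` {c..d})"
      using shadowing_interval[OF eps] by (elim exE conjE) (rule that)
    show ?thesis
    \<comment> \<open>The extra 1 makes \<open>p\<close> positive even when \<open>M\<close> is
      0.\<close>
    proof (intro exI[of _ "int (Suc M)"] allI impI, elim conjE)
      fix k p :: nat and x :: "nat \<Rightarrow> real" and a b :: "nat \<Rightarrow> nat"
      assume k: "k > 1" and x: "\<forall>i\<in>{1..k}. x i \<in> {0..1}" and ab: "\<forall>i\<in>{1..k}. a i \<le> b i"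
        and "\<forall>i\<in>{2..k}. b (i - 1) < a i"
        and gap_int: "\<forall>i\<in>{2..k}. int (a i) - int (b (i - 1)) \<ge> int (Suc M)"
        and p_int: "int p \<ge> int (Suc M) + int (b k) - int (a 1)"
      have gap: "b i + Suc M \<le> a (Suc i)" if "i \<in> {1..<k}" for i
        using gap_int[rule_format, of "Suc i"] that by auto
      have p: "Suc M + b k \<le> p + a 1" using p_int by linarith
      have "\<forall>i\<in>{1..k}. \<exists>c d. A \<le> c \<and> c \<le> d \<and> d \<le> B \<and>
        (\<forall>t\<in>{c..d}. \<forall>j\<le>b i - a i. \<bar>(f ^^ j) t - (f ^^ j) ((f ^^ a i) (x i))\<bar> \<le> \<epsilon>) \<and>
        (\<forall>m\<ge>b i - a i + M. {A..B} \<subseteq> (f ^^ m) ` {c..d})"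
        using x by (intro ballI piece[rule_format] iter_maps) simp
      from bchoice[OF this] obtain c where "\<forall>i\<in>{1..k}. \<exists>d. A \<le> c i \<and> c i \<le> d \<and> d \<le> B \<and>
        (\<forall>t\<in>{c i..d}. \<forall>j\<le>b i - a i. \<bar>(f ^^ j) t - (f ^^ j) ((f ^^ a i) (x i))\<bar> \<le> \<epsilon>) \<and>
        (\<forall>m\<ge>b i - a i + M. {A..B} \<subseteq> (f ^^ m) ` {c i..d})" ..
      from bchoice[OF this] obtain d where d: "\<forall>i\<in>{1..k}. A \<le> c i \<and> c i \<le> d i \<and> d i \<le> B \<and>
        (\<forall>t\<in>{c i..d i}. \<forall>j\<le>b i - a i. \<bar>(f ^^ j) t - (f ^^ j) ((f ^^ a i) (x i))\<bar> \<le> \<epsilon>) \<and>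
        (\<forall>m\<ge>b i - a i + M. {A..B} \<subseteq> (f ^^ m) ` {c i..d i})" ..
      have cd: "A \<le> c i \<and> c i \<le> d i \<and> d i \<le> B" if "i \<in> {1..k}" for i
        using bspec[OF d that] by simp
      have near: "\<bar>(f ^^ j) t - (f ^^ j) ((f ^^ a i) (x i))\<bar> \<le> \<epsilon>"
        if "i \<in> {1..k}" "t \<in> {c i..d i}" "j \<le> b i - a i" for i t j
        using bspec[OF d that(1)] that(2,3) by simp
      have cover: "{A..B} \<subseteq> (f ^^ m) ` {c i..d i}" if "i \<in> {1..k}" "m \<ge> b i - a i + M" for i m
        using bspec[OF d that(1)] that(2) by simp
      have a_mono: "a i \<le> a (Suc i)" if "i \<in> {1..<k}" for i
        using gap[OF that] ab[rule_format, of i] that by auto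
      have step: "{c (Suc i)..d (Suc i)} \<subseteq> (f ^^ (a (Suc i) - a i)) ` {c i..d i}" if i: "i \<in> {1..<k}" for i
      proof -
        have "{c (Suc i)..d (Suc i)} \<subseteq> {A..B}" using cd[of "Suc i"] i by auto
        also have "\<dots> \<subseteq> (f ^^ (a (Suc i) - a i)) ` {c i..d i}"
          using gap[OF i] ab[rule_format, of i] i by (intro cover) auto
        finally show ?thesis .
      qed
      have inside: "0 \<le> c i \<and> c i \<le> d i \<and> d i \<le> 1" if "i \<in> {1..k}" for i
        using cd[OF that] AB by auto
      have "\<exists>\<alpha> \<beta>. c 1 \<le> \<alpha> \<and> \<alpha> \<le> \<beta> \<and> \<beta> \<le> d 1 \<and> a 1 \<le> a k \<and>
        (\<forall>i\<in>{1..k}. (f ^^ (a i - a 1)) ` {\<alpha>..\<beta>} \<subseteq> {c i..d i}) \<and>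
        (f ^^ (a k - a 1)) ` {\<alpha>..\<beta>} = {c k..d k}"
        using k by (intro chain_interval inside a_mono step) simp_all
      then obtain \<alpha> \<beta> where \<alpha>\<beta>: "c 1 \<le> \<alpha>" "\<alpha> \<le> \<beta>" "\<beta> \<le> d 1" "a 1 \<le> a k"
        and itin: "\<forall>i\<in>{1..k}. (f ^^ (a i - a 1)) ` {\<alpha>..\<beta>} \<subseteq> {c i..d i}"
        and lastim: "(f ^^ (a k - a 1)) ` {\<alpha>..\<beta>} = {c k..d k}"
        by (elim exE conjE) (rule that)
      have bk: "a k \<le> b k" using ab k by auto
      have "{\<alpha>..\<beta>} \<subseteq> {A..B}" using \<alpha>\<beta> cd[of 1] k by auto
      \<comment> \<open>After reaching the last interval, at least \<open>b k - a k + M\<close>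
        steps of the period remain, enough to cover the core.\<close>
      also have "\<dots> \<subseteq> (f ^^ (p - (a k - a 1))) ` (f ^^ (a k - a 1)) ` {\<alpha>..\<beta>}"
        unfolding lastim using p \<alpha>\<beta>(4) bk k by (intro cover) auto
      also have "\<dots> = (f ^^ p) ` {\<alpha>..\<beta>}"
        using p \<alpha>\<beta>(4) bk by (simp add: image_comp flip: funpow_add)
      finally have pcover: "{\<alpha>..\<beta>} \<subseteq> (f ^^ p) ` {\<alpha>..\<beta>}" .
      have \<alpha>\<beta>01: "0 \<le> \<alpha>" "\<beta> \<le> 1" using \<alpha>\<beta> cd[of 1] AB k by auto
      obtain w where w: "w \<in> {\<alpha>..\<beta>}" "(f ^^ p) w = w"
        using fixed_point_of_cover[OF iter_cont_sub[OF \<alpha>\<beta>01] \<alpha>\<beta>(2) pcover] ..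
      \<comment> \<open>Positivity of \<open>p\<close> keeps the subtraction in
        \<open>p * a 1 - a 1\<close> from truncating.\<close>
      have p1: "1 \<le> p" using p \<alpha>\<beta>(4) bk by linarith
      \<comment> \<open>\<open>w\<close> lives at time \<open>a 1\<close>; its periodicity allows us to go back to time \<open>0\<close>\<close>
      define z where "z = (f ^^ (p * a 1 - a 1)) w"
      have wper: "(f ^^ (p * j)) w = w" for j
      proof (induction j)
        case (Suc j)
        then show ?case using w(2) by (simp add: funpow_add)
      qed simp
      have z01: "z \<in> {0..1}" unfolding z_def using w(1) \<alpha>\<beta>01 by (intro iter_maps) auto
      have za: "(f ^^ a 1) z = w"
      proof -
        have "a 1 \<le> p * a 1" using p1 by simp
        then show ?thesis unfolding z_def using wper[of "a 1"] by (simp flip: funpow_add_apply)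
      qed
      have zper: "(f ^^ p) z = z"
      proof -
        have "(f ^^ p) z = (f ^^ (p * a 1 - a 1)) ((f ^^ p) w)"
          unfolding z_def by (simp add: add.commute flip: funpow_add_apply)
        then show ?thesis using w(2) by (simp add: z_def)
      qed
      have "dist ((f ^^ n) z) ((f ^^ n) (x i)) \<le> \<epsilon>" if i: "i \<in> {1..k}" and n: "n \<in> {a i..b i}" for i n
      proof -
        have ai: "a 1 \<le> a i"
        proof -
          have "1 \<le> i" using i by simp
          then show ?thesis using i
            by (induction i rule: nat_induct_at_least) (use a_mono in \<open>auto intro: order_trans\<close>)
        qed
        have "(f ^^ (a i - a 1)) w \<in> {c i..d i}" using subsetD[OF bspec[OF itin i] imageI[OF w(1)]] .
        then have "\<bar>(f ^^ (n - a i)) ((f ^^ (a i - a 1)) w) - (f ^^ (n - a i)) ((f ^^ a i) (x i))\<bar> \<le> \<epsilon>"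
          using n by (intro near[OF i]) auto
        moreover have "(f ^^ (n - a i)) ((f ^^ (a i - a 1)) w) = (f ^^ n) z"
          unfolding za[symmetric] using ai n by (simp flip: funpow_add_apply)
        moreover have "(f ^^ (n - a i)) ((f ^^ a i) (x i)) = (f ^^ n) (x i)"
          using n by (simp flip: funpow_add_apply)
        ultimately show ?thesis by (simp add: dist_real_def)
      qed
      then show "\<exists>z\<in>{0..1}. (f ^^ p) z = z \<and>
          (\<forall>i\<in>{1..k}. \<forall>n\<in>{a i..b i}. dist ((f ^^ n) z) ((f ^^ n) (x i)) \<le> \<epsilon>)"
        using z01 zper by (intro bexI[of _ z] conjI ballI)
    qed
  qed
  then show ?thesis
    unfolding specification_property_def continuous_self_map_def
    using cont maps infinite_Icc[of 0 "1::real"] by auto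
qed

end

section \<open>Mixing in terms of open intervals\<close>

lemma interval_mixing_of_mixing:
  assumes "mixing {0..1::real} f"
  shows "interval_mixing f"
proof
  show "continuous_on {0..1} f" "\<And>x. x \<in> {0..1} \<Longrightarrow> f x \<in> {0..1}"
    using assms by (auto simp: mixing_def continuous_self_map_def)
  fix a b c d :: real
  assume "0 \<le> a" "a < b" "b \<le> 1" "0 \<le> c" "c < d" "d \<le> 1"
  moreover have "openin (top_of_set {0..1}) {s<..<t}" if "0 \<le> s" "t \<le> 1" for s t :: real
    using that by (intro open_subset) auto
  ultimately obtain N where "\<forall>n>N. (f ^^ n) ` {a<..<b} \<inter> {c<..<d} \<noteq> {}"
    using assms unfolding mixing_def by (metis greaterThanLessThan_empty_iff not_le)
  then show "\<exists>N. \<forall>n>N. \<exists>x\<in>{a<..<b}. (f ^^ n) x \<in> {c<..<d}" by blast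
qed

theorem theorem8p7:
  fixes f :: "real \<Rightarrow> real"
  assumes "continuous_on {0..1} f"
    and "f \<in> {0..1} \<rightarrow> {0..1}"
    and "mixing {0..1} f"
  shows "specification_property {0..1} f"
  using interval_mixing.has_specification_property[OF interval_mixing_of_mixing[OF assms(3)]] .

end
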